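(* Let $q=\frac{2\log 3}{\log 5}$. For every $d\geq 1$ and all functions $f,g:\mathbb{Z}^d\to[0,\infty)$ supported on $\{0,1,2\}^d$, $$\|f\,\bar{*}\,g\|_{1}\geq \|f\|_{q}\,\|g\|_{q}.$$ In particular, for all $d\ge 1$ and all $A,B\subseteq\{0,1,2\}^d$, $$|A+B|\geq |A|^{p}|B|^{p},\qquad p=\frac{\log 5}{2\log 3},$$ and this power $p$ is the best possible, i.e. it cannot be replaced by any larger number.
   Context: For $r\ge 1$ and finitely supported $f:\mathbb{Z}^d\to\mathbb{R}$, $\|f\|_r=\left(\sum_{x\in\mathbb{Z}^d}|f(x)|^r\right)^{1/r}$ (this expression is also used for $0<r<1$). The sup-convolution of finitely supported $f,g:\mathbb{Z}^d\to\mathbb{R}$ is $f\bar{*}g(z)=\sup_{x\in\mathbb{Z}^d} f(x)g(z-x)$. $A+B=\{a+b: a\in A, b\in B\}$ and $|\cdot|$ denotes cardinality. *)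

theory Defs
  imports
    "HOL-Analysis.Analysis"
    "HOL-Library.Function_Algebras"
    "HOL-Library.Set_Algebras"
begin

text \<open>
  The lattice \<open>\<int>\<^sup>d\<close> is modelled by the integer sequences that vanish from index \<open>d\<close> on, so that
  the dimension can be quantified inside a formula. This set is closed under the pointwise
  \<open>+\<close> and \<open>-\<close> of functions, and sumsets are those of \<open>Set_Algebras\<close>. A function on \<open>\<int>\<^sup>d\<close> is a
  function on all sequences whose values outside \<open>int_lattice d\<close> are never looked at.
\<close>

definition int_lattice :: "nat \<Rightarrow> (nat \<Rightarrow> int) set" where
  "int_lattice d = {x. \<forall>i\<ge>d. x i = 0}"

definition cube012 :: "nat \<Rightarrow> (nat \<Rightarrow> int) set" where
  "cube012 d = {x \<in> int_lattice d. \<forall>i<d. x i \<in> {0, 1, 2}}"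

text \<open>Only meant for finitely supported functions and \<open>r > 0\<close>; note that \<open>0 powr r = 0\<close>.\<close>

definition lnorm :: "nat \<Rightarrow> real \<Rightarrow> ((nat \<Rightarrow> int) \<Rightarrow> real) \<Rightarrow> real" where
  "lnorm d r f = (\<Sum>\<^sub>\<infinity>x\<in>int_lattice d. \<bar>f x\<bar> powr r) powr (1 / r)"

definition sup_conv ::
  "nat \<Rightarrow> ((nat \<Rightarrow> int) \<Rightarrow> real) \<Rightarrow> ((nat \<Rightarrow> int) \<Rightarrow> real) \<Rightarrow> (nat \<Rightarrow> int) \<Rightarrow> real" where
  "sup_conv d f g z = (SUP x\<in>int_lattice d. f x * g (z - x))"

end

theory Submission
  imports Defs
begin

text \<open>
  By induction on the dimension the inequality tensorizes, so it suffices to treat \<open>d = 1\<close>. There,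
  let \<open>S(f, g) = \<parallel>f \<^bold>\<star> g\<parallel>\<^sub>1\<close> be the sum of the sup-convolution of two functions on \<open>{0, 1, 2}\<close>. One has
  \<open>S(f, f) S(g, g) \<le> S(f, g)\<^sup>2\<close>, even coefficientwise when the sup-convolutions are read as
  polynomials, which reduces everything to \<open>f = g\<close>. For \<open>f = (a, b, c)\<close>, concavity in \<open>b\<^sup>q\<close>
  (if \<open>b\<^sup>2 \<le> a c\<close>) or in the \<open>q\<close>-th power of a scaling of \<open>a\<close> and \<open>c\<close> (if \<open>b\<^sup>2 \<ge> a c\<close>)
  reduces further to the cases where an entry vanishes or \<open>f = (t, 1, 1/t)\<close> is geometric. In the geometric case put \<open>t = exp s\<close>: the
  logarithm of the quotient of both sides vanishes at \<open>s = 0\<close> and at infinity, and its derivative is a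
  positive multiple of a concave function vanishing at \<open>0\<close>, so it first increases and then decreases.
  The exponent is sharp because equality holds for \<open>A = B = {0, 1, 2}\<close>.
\<close>

section \<open>Reduction to equal functions\<close>

text \<open>
  The next three lemmas compare the coefficients of degree \<open>n = 2, 3, 4\<close> in
  \<open>F(t) G(t)\<close> and \<open>H(t)\<^sup>2\<close>, where \<open>F, G, H\<close> are the polynomials with coefficient
  sequences \<open>f \<^bold>\<star> f\<close>, \<open>g \<^bold>\<star> g\<close>, \<open>f \<^bold>\<star> g\<close> (sup-convolutions) for \<open>f = (a, b, c)\<close> and \<open>g = (x, y, z)\<close>.
  They are stated in terms of \<open>s = a x\<close>, \<open>P = a y\<close>, \<open>Q = b x\<close>, \<open>u = a z\<close>, \<open>v = b y\<close>, \<open>w = c x\<close>;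
  the degrees 5 and 6 follow by reversing \<open>f\<close> and \<open>g\<close>.
\<close>

lemma sup_square_sum_diag2:
  fixes s P Q u v w :: real
  assumes "s \<ge> 0" "P \<ge> 0" "Q \<ge> 0" "s * v = P * Q"
  shows "max (P\<^sup>2) (s * u) + max (Q\<^sup>2) (s * w) + P * Q
    \<le> 2 * (s * Max {u, v, w}) + (max P Q)\<^sup>2"
proof -
  have *: "s * u \<le> s * Max {u, v, w}" "s * v \<le> s * Max {u, v, w}" "s * w \<le> s * Max {u, v, w}"
    using assms(1) by (auto intro!: mult_left_mono)
  have "P\<^sup>2 \<le> (max P Q)\<^sup>2" "Q\<^sup>2 \<le> (max P Q)\<^sup>2"
    using assms by (auto intro!: power_mono)
  moreover have "P * Q \<le> (max P Q)\<^sup>2"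
    unfolding power2_eq_square using assms by (intro mult_mono) auto
  \<comment> \<open>The smaller of the two squares is at most \<open>P * Q\<close>; the larger one
    is \<open>(max P Q)^2\<close>.\<close>
  moreover have "P\<^sup>2 + Q\<^sup>2 \<le> (max P Q)\<^sup>2 + P * Q"
    using assms by (auto simp: max_def power2_eq_square mult_right_mono mult_left_mono)
  ultimately show ?thesis
    using * assms(4) by (auto simp: max_def)
qed

lemma sup_square_sum_diag3:
  fixes P Q u v w :: real
  assumes "P \<ge> 0" "Q \<ge> 0" "u \<ge> 0" "v \<ge> 0" "w \<ge> 0"
  shows "P * u + Q * w + max (P * v) (Q * u) + max (Q * v) (P * w)
    \<le> 2 * max (Q * u) (P * w) + 2 * (max P Q * Max {u, v, w})"
proof -
  have *: "P * u + Q * w + max (P * v) (Q * u) + max (Q * v) (P * w)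
    \<le> 2 * max (Q * u) (P * w) + 2 * (P * Max {u, v, w})"
    if "P \<ge> Q" "Q \<ge> 0" "u \<ge> 0" "v \<ge> 0" "w \<ge> 0" for P Q u v w :: real
  proof -
    have PQ: "Q * u \<le> P * u" "Q * v \<le> P * v" "Q * w \<le> P * w"
      using that by (auto intro!: mult_right_mono)
    have m: "P * u \<le> P * Max {u, v, w}" "P * v \<le> P * Max {u, v, w}" "P * w \<le> P * Max {u, v, w}"
      using that by (auto intro!: mult_left_mono)
    show ?thesis
    \<comment> \<open>The delicate case is \<open>u > w\<close> with both inner maxima attained by
      their \<open>v\<close> terms; elsewhere monotonicity of the single products is enough.\<close>
    proof (cases "w \<ge> u \<or> max (P * v) (Q * u) \<noteq> P * v \<or> max (Q * v) (P * w) \<noteq> Q * v")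
      case True
      moreover have "w \<ge> u \<Longrightarrow> P * u \<le> P * w"
        using that by (auto intro!: mult_left_mono)
      ultimately show ?thesis
        using PQ m by (auto simp: max_def split: if_splits)
    next
      case False
      then have "u > w" and h: "max (P * v) (Q * u) = P * v" "max (Q * v) (P * w) = Q * v"
        by auto
      have "P * u + P * v + Q * v \<le> Q * u + 2 * (P * Max {u, v, w})"
      proof (cases "u \<ge> v")
        case True
        then have "Max {u, v, w} = u" "P * v \<le> P * u" "Q * v \<le> Q * u"
          using \<open>u > w\<close> that by (auto intro!: mult_left_mono)
        then show ?thesis by simp
      next
        case False
        then have "Max {u, v, w} = v" "(P - Q) * (v - u) \<ge> 0"
          using \<open>u > w\<close> that by (auto intro!: mult_nonneg_nonneg)
        then show ?thesis by (simp add: algebra_simps)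
      qed
      then show ?thesis unfolding h using PQ by (auto simp: max_def)
    qed
  qed
  show ?thesis
  proof (cases "P \<ge> Q")
    case True
    then show ?thesis using *[of Q P u v w] assms by (simp add: max_absorb1)
  next
    case False
    then show ?thesis using *[of P Q w v u] assms
      by (simp add: max_absorb2 max.commute insert_commute max.left_commute add.commute)
  qed
qed

lemma sup_square_sum_diag4:
  fixes u v w e e' K :: real
  assumes "u \<ge> 0" "v \<ge> 0" "w \<ge> 0"
    and "e \<le> K" "e' \<le> K" "u * v \<le> K" "v * w \<le> K"
  shows "u\<^sup>2 + w\<^sup>2 + u * v + v * w + Max {v\<^sup>2, u * w, e, e'}
    \<le> 2 * (u * w) + 2 * K + (Max {u, v, w})\<^sup>2"
proof -
  \<comment> \<open>In the application \<open>e\<close> and \<open>e'\<close> are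
    \<open>(b * x) * (b * z)\<close> and \<open>(a * y) * (c * y)\<close>, and \<open>K\<close> is
    the product of the sup-convolution values at 1 and 3.\<close>
  have *: "u\<^sup>2 + w\<^sup>2 + u * v + v * w + Max {v\<^sup>2, u * w, e, e'}
    \<le> 2 * (u * w) + 2 * K + (Max {u, v, w})\<^sup>2"
    if "u \<ge> w" "u \<ge> 0" "v \<ge> 0" "w \<ge> 0" "e \<le> K" "e' \<le> K" "u * v \<le> K" "v * w \<le> K"
    for u v w e e' K :: real
  proof (cases "u \<ge> v")
    case True
    have "w * w \<le> u * w" "v * w \<le> u * v" "v * w \<le> u * w" "v * v \<le> u * v"
      using that True by (auto intro!: mult_mono simp: mult.commute[of u v])
    then show ?thesis using that True
      by (auto simp: power2_eq_square)
  next
    case False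
    have 1: "w * w \<le> u * w" "u * w \<le> v * w" "w * v \<le> u * v" "u * u \<le> u * v" "u * v \<le> v * v"
      using that False by (auto intro!: mult_mono)
    \<comment> \<open>The first product settles the case where the four-fold maximum is
      \<open>v^2\<close>, the second one the cases where it is at most \<open>K\<close>.\<close>
    have 2: "(u - w) * (v - u + w) \<ge> 0" "(v - u) * (v + u - w) \<ge> 0"
      using that False by (auto intro!: mult_nonneg_nonneg)
    show ?thesis using that False 1 2
      by (auto simp: power2_eq_square algebra_simps)
  qed
  show ?thesis
  proof (cases "u \<ge> w")
    case True
    then show ?thesis using *[of w u v e K e'] assms by simp
  next
    case False
    then show ?thesis using *[of u w v e K e'] assms
      by (simp add: mult.commute max.commute max.left_commute add.commute add.left_commute)
  qed
qed

text \<open>For nonnegative entries the five summands are the values at 0, ..., 4 of the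
  sup-convolution of \<open>(a, b, c)\<close> and \<open>(x, y, z)\<close>.\<close>

definition supsum3 :: "real \<Rightarrow> real \<Rightarrow> real \<Rightarrow> real \<Rightarrow> real \<Rightarrow> real \<Rightarrow> real" where
  "supsum3 a b c x y z = a * x + max (a * y) (b * x) + Max {a * z, b * y, c * x}
     + max (b * z) (c * y) + c * z"

lemma supsum3_diag: "supsum3 a b c a b c = a\<^sup>2 + a * b + max (b\<^sup>2) (a * c) + b * c + c\<^sup>2"
  by (simp add: supsum3_def power2_eq_square mult.commute max.commute)

text \<open>Both sides are values at 1 of polynomials of degree 8. The facts \<open>d1\<close> to
  \<open>d7\<close> compare the coefficients of degrees 1 to 7; those of degrees 0 and 8
  agree.\<close>

lemma supsum3_square_ge:
  assumes "a \<ge> 0" "b \<ge> 0" "c \<ge> 0" "x \<ge> 0" "y \<ge> 0" "z \<ge> 0"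
  shows "supsum3 a b c a b c * supsum3 x y z x y z \<le> (supsum3 a b c x y z)\<^sup>2"
proof -
  define M L where "M = max (b\<^sup>2) (a * c)" and "L = max (y\<^sup>2) (x * z)"
  define H1 H2 H3 where "H1 = max (a * y) (b * x)" and "H2 = Max {a * z, b * y, c * x}"
    and "H3 = max (b * z) (c * y)"
  have "max (r * s) (r * t) = r * max s t" if "r \<ge> 0" for r s t :: real
    using that by (simp add: max_mult_distrib_left)
  note mx = this
  \<comment> \<open>The equations \<open>aL\<close> to \<open>zyM\<close> write each product of a
    coefficient with \<open>M\<close> or \<open>L\<close> as a maximum of the shape used in the
    degree lemmas.\<close>
  have aL: "max ((a * y)\<^sup>2) ((a * x) * (a * z)) = a\<^sup>2 * L"
    unfolding L_def mx[symmetric, OF zero_le_power2] by (simp add: power2_eq_square mult_ac)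
  have xM: "max ((b * x)\<^sup>2) ((a * x) * (c * x)) = x\<^sup>2 * M"
    unfolding M_def mx[symmetric, OF zero_le_power2] by (simp add: power2_eq_square mult_ac)
  have cL: "max ((c * y)\<^sup>2) ((c * z) * (c * x)) = c\<^sup>2 * L"
    unfolding L_def mx[symmetric, OF zero_le_power2] by (simp add: power2_eq_square mult_ac)
  have zM: "max ((b * z)\<^sup>2) ((c * z) * (a * z)) = z\<^sup>2 * M"
    unfolding M_def mx[symmetric, OF zero_le_power2] by (simp add: power2_eq_square mult_ac)
  have abL: "max ((a * y) * (b * y)) ((b * x) * (a * z)) = a * b * L"
    unfolding L_def mx[symmetric, OF mult_nonneg_nonneg[OF assms(1,2)]] by (simp add: power2_eq_square mult_ac)
  have xyM: "max ((b * x) * (b * y)) ((a * y) * (c * x)) = x * y * M"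
    unfolding M_def mx[symmetric, OF mult_nonneg_nonneg[OF assms(4,5)]] by (simp add: power2_eq_square mult_ac)
  have cbL: "max ((c * y) * (b * y)) ((b * z) * (c * x)) = c * b * L"
    unfolding L_def mx[symmetric, OF mult_nonneg_nonneg[OF assms(3,2)]] by (simp add: power2_eq_square mult_ac)
  have zyM: "max ((b * z) * (b * y)) ((c * y) * (a * z)) = z * y * M"
    unfolding M_def mx[symmetric, OF mult_nonneg_nonneg[OF assms(6,5)]] by (simp add: power2_eq_square mult_ac)
  have nn: "a * x \<ge> 0" "a * y \<ge> 0" "a * z \<ge> 0" "b * x \<ge> 0" "b * y \<ge> 0" "b * z \<ge> 0"
    "c * x \<ge> 0" "c * y \<ge> 0" "c * z \<ge> 0"
    using assms by auto
  have H2': "Max {c * x, b * y, a * z} = H2"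
    unfolding H2_def by (simp add: max.commute max.left_commute)
  have d1: "a\<^sup>2 * (x * y) + (a * b) * x\<^sup>2 \<le> 2 * (a * x * H1)"
    using mult_left_mono[OF max.cobounded1[of "a * y" "b * x"] nn(1)]
      mult_left_mono[OF max.cobounded2[of "b * x" "a * y"] nn(1)]
    unfolding H1_def by (simp add: power2_eq_square mult_ac)
  have d7: "c\<^sup>2 * (y * z) + (b * c) * z\<^sup>2 \<le> 2 * (c * z * H3)"
    using mult_left_mono[OF max.cobounded1[of "b * z" "c * y"] nn(9)]
      mult_left_mono[OF max.cobounded2[of "c * y" "b * z"] nn(9)]
    unfolding H3_def by (simp add: power2_eq_square mult_ac)
  have d2: "a\<^sup>2 * L + x\<^sup>2 * M + (a * b) * (x * y) \<le> 2 * (a * x * H2) + H1\<^sup>2"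
    using sup_square_sum_diag2[of "a * x" "a * y" "b * x" "b * y" "a * z" "c * x"] nn
    unfolding aL xM H1_def H2_def by (simp add: mult_ac)
  have d6: "c\<^sup>2 * L + z\<^sup>2 * M + (b * c) * (y * z) \<le> 2 * (c * z * H2) + H3\<^sup>2"
    using sup_square_sum_diag2[of "c * z" "c * y" "b * z" "b * y" "c * x" "a * z"] nn
    unfolding cL zM H2' H3_def by (simp add: mult_ac max.commute)
  have d3: "a\<^sup>2 * (y * z) + (b * c) * x\<^sup>2 + (a * b) * L + (x * y) * M
     \<le> 2 * (a * x * H3) + 2 * (H1 * H2)"
  proof -
    have "a * x * H3 = max ((b * x) * (a * z)) ((a * y) * (c * x))"
      unfolding H3_def mx[OF nn(1), symmetric] by (simp add: mult_ac)
    then show ?thesis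
      using sup_square_sum_diag3[of "a * y" "b * x" "a * z" "b * y" "c * x"] nn
      unfolding abL xyM H1_def H2_def by (simp add: power2_eq_square mult_ac)
  qed
  have d5: "c\<^sup>2 * (x * y) + (a * b) * z\<^sup>2 + (b * c) * L + (y * z) * M
     \<le> 2 * (c * z * H1) + 2 * (H2 * H3)"
  proof -
    have "c * z * H1 = max ((b * z) * (c * x)) ((c * y) * (a * z))"
      unfolding H1_def mx[OF nn(9), symmetric] by (simp add: mult_ac max.commute)
    then show ?thesis
      using sup_square_sum_diag3[of "c * y" "b * z" "c * x" "b * y" "a * z"] nn
      unfolding cbL zyM H3_def H2' by (simp add: power2_eq_square mult_ac max.commute)
  qed
  have d4: "a\<^sup>2 * z\<^sup>2 + c\<^sup>2 * x\<^sup>2 + (a * b) * (y * z) + (b * c) * (x * y) + M * L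
    \<le> 2 * (a * x * (c * z)) + 2 * (H1 * H3) + H2\<^sup>2"
  proof -
    have K: "r * s \<le> H1 * H3" if "r \<in> {a * y, b * x}" "s \<in> {b * z, c * y}" for r s
      using that nn unfolding H1_def H3_def by (intro mult_mono) auto
    have 1: "(b * x) * (b * z) \<le> H1 * H3" "(a * y) * (c * y) \<le> H1 * H3"
      "(a * z) * (b * y) \<le> H1 * H3" "(b * y) * (c * x) \<le> H1 * H3"
      using K[of "b * x" "b * z"] K[of "a * y" "c * y"] K[of "a * y" "b * z"] K[of "b * x" "c * y"]
      by (simp_all add: mult_ac)
    \<comment> \<open>A product of two binary maxima is one of four products, regrouped here so that
      each is a product of two terms of the mixed sup-convolution.\<close>
    have "M * L \<le> Max {(b * y)\<^sup>2, (a * z) * (c * x), (b * x) * (b * z), (a * y) * (c * y)}"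
      unfolding M_def L_def by (auto simp: max_def power2_eq_square mult_ac)
    then show ?thesis
      using sup_square_sum_diag4[OF nn(3,5,7) 1] unfolding H2_def
      by (simp add: power2_eq_square mult_ac)
  qed
  have S: "supsum3 a b c x y z = a * x + H1 + H2 + H3 + c * z"
    by (simp add: supsum3_def H1_def H2_def H3_def)
  show ?thesis
    using d1 d2 d3 d4 d5 d6 d7 unfolding supsum3_diag S M_def[symmetric] L_def[symmetric]
    by (simp add: power2_eq_square algebra_simps)
qed

section \<open>Tensorization\<close>

text \<open>The side length is a parameter because the sup-convolution of functions on side 2 lives
  on side 4.\<close>

definition lattice_box :: "int \<Rightarrow> nat \<Rightarrow> (nat \<Rightarrow> int) set" where
  "lattice_box k d = {x \<in> int_lattice d. \<forall>i<d. x i \<in> {0..k}}"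

lemma cube012_eq_lattice_box: "cube012 d = lattice_box 2 d"
proof -
  have "{0, 1, 2} = {0..2::int}" by auto
  then show ?thesis by (simp add: cube012_def lattice_box_def)
qed

lemma lattice_box_0: "lattice_box k 0 = {0}"
  by (auto simp: lattice_box_def int_lattice_def fun_eq_iff)

text \<open>Splits off the coordinate with index \<open>d\<close>; resetting it to 0 returns the
  rest to dimension \<open>d\<close>.\<close>

lemma bij_betw_lattice_box_Suc:
  "bij_betw (\<lambda>(a, x). x(d := a)) ({0..k} \<times> lattice_box k d) (lattice_box k (Suc d))"
proof (rule bij_betw_byWitness[where f' = "\<lambda>x. (x d, x(d := 0))"])
  show "\<forall>ax\<in>{0..k} \<times> lattice_box k d. (\<lambda>x. (x d, x(d := 0))) ((\<lambda>(a, x). x(d := a)) ax) = ax"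
    by (auto simp: lattice_box_def int_lattice_def fun_eq_iff)
  show "\<forall>x\<in>lattice_box k (Suc d). (\<lambda>(a, x). x(d := a)) ((\<lambda>x. (x d, x(d := 0))) x) = x"
    by auto
  show "(\<lambda>(a, x). x(d := a)) ` ({0..k} \<times> lattice_box k d) \<subseteq> lattice_box k (Suc d)"
    by (auto simp: lattice_box_def int_lattice_def less_Suc_eq)
  show "(\<lambda>x. (x d, x(d := 0))) ` lattice_box k (Suc d) \<subseteq> {0..k} \<times> lattice_box k d"
    by (auto simp: lattice_box_def int_lattice_def)
qed

lemma finite_lattice_box: "finite (lattice_box k d)"
proof (induction d)
  case (Suc d)
  then show ?case using bij_betw_finite[OF bij_betw_lattice_box_Suc[of d k]] by simp
qed (simp add: lattice_box_0)

lemma sum_lattice_box_Suc: "(\<Sum>x\<in>lattice_box k (Suc d). f x) = (\<Sum>a=0..k. \<Sum>x\<in>lattice_box k d. f (x(d := a)))"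
proof -
  have "(\<Sum>x\<in>lattice_box k (Suc d). f x) = (\<Sum>ax\<in>{0..k} \<times> lattice_box k d. f (case ax of (a, x) \<Rightarrow> x(d := a)))"
    by (rule sum.reindex_bij_betw[OF bij_betw_lattice_box_Suc, symmetric])
  then show ?thesis
    by (simp add: sum.cartesian_product case_prod_unfold)
qed

lemma lattice_box_add: "x \<in> lattice_box k d \<Longrightarrow> y \<in> lattice_box l d \<Longrightarrow> x + y \<in> lattice_box (k + l) d"
  by (fastforce simp: lattice_box_def int_lattice_def)

text \<open>Induction on the dimension, slicing by the last coordinate. An arbitrary majorant
  \<open>h\<close> in place of the sup-convolution makes the induction hypothesis apply to slices
  and also covers indicator functions.\<close>

lemma sum_lattice_box_ge_prod:
  fixes p q :: real and f g h :: "(nat \<Rightarrow> int) \<Rightarrow> real"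
  assumes one_dim: "\<And>a b c x y z. \<lbrakk>a \<ge> 0; b \<ge> 0; c \<ge> 0; x \<ge> 0; y \<ge> 0; z \<ge> 0\<rbrakk> \<Longrightarrow>
      (a powr q + b powr q + c powr q) powr p * (x powr q + y powr q + z powr q) powr p
      \<le> supsum3 a b c x y z"
    and pq: "p * q = 1"
    and f: "\<And>x. x \<in> lattice_box 2 d \<Longrightarrow> f x \<ge> 0" and g: "\<And>x. x \<in> lattice_box 2 d \<Longrightarrow> g x \<ge> 0"
    and h: "\<And>x y. x \<in> lattice_box 2 d \<Longrightarrow> y \<in> lattice_box 2 d \<Longrightarrow> f x * g y \<le> h (x + y)"
  shows "(\<Sum>x\<in>lattice_box 2 d. f x powr q) powr p * (\<Sum>x\<in>lattice_box 2 d. g x powr q) powr p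
    \<le> (\<Sum>z\<in>lattice_box 4 d. h z)"
  using f g h
proof (induction d arbitrary: f g h)
  case 0
  then show ?case using pq
    by (simp add: lattice_box_0 powr_powr mult.commute[of q])
next
  case (Suc d)
  define F where "F f a = (\<Sum>x\<in>lattice_box 2 d. f (x(d := a)) powr q)"
    for f :: "(nat \<Rightarrow> int) \<Rightarrow> real" and a :: int
  define H where "H c = (\<Sum>z\<in>lattice_box 4 d. h (z(d := c)))" for c
  have upd: "x(d := a) \<in> lattice_box 2 (Suc d)" if "x \<in> lattice_box 2 d" "a \<in> {0..2}" for x a
    using that by (auto simp: lattice_box_def int_lattice_def less_Suc_eq)
  have F0: "F f a \<ge> 0" for f a
    unfolding F_def by (intro sum_nonneg) auto
  \<comment> \<open>The slices of \<open>f\<close> at height \<open>a\<close> and of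
    \<open>g\<close> at height \<open>b\<close> are dominated by the slice of \<open>h\<close> at
    height \<open>a + b\<close>.\<close>
  have FH: "F f a powr p * F g b powr p \<le> H (a + b)" if "a \<in> {0..2}" "b \<in> {0..2}" for a b
    unfolding F_def H_def
  proof (rule Suc.IH)
    fix x y assume xy: "x \<in> lattice_box 2 d" "y \<in> lattice_box 2 d"
    have "x(d := a) + y(d := b) = (x + y)(d := a + b)"
      by auto
    then show "f (x(d := a)) * g (y(d := b)) \<le> h ((x + y)(d := a + b))"
      using Suc.prems(3)[OF upd[OF xy(1) that(1)] upd[OF xy(2) that(2)]] by metis
  qed (rule Suc.prems upd that | assumption)+
  \<comment> \<open>The one-dimensional inequality is applied to the numbers
    \<open>F f a powr p\<close>; their \<open>q\<close>-th powers are the slice sums again.\<close>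
  have F_pq: "(F f a powr p) powr q = F f a" for f a
    using F0[of f a] pq by (simp add: powr_powr)
  have set012: "{0..2} = {0, 1, 2::int}" and set01234: "{0..4} = {0, 1, 2, 3, 4::int}"
    by auto
  have sum_F: "(\<Sum>x\<in>lattice_box 2 (Suc d). f x powr q) = F f 0 + F f 1 + F f 2" for f
    unfolding sum_lattice_box_Suc F_def set012 by simp
  have sum_H: "(\<Sum>z\<in>lattice_box 4 (Suc d). h z) = H 0 + H 1 + H 2 + H 3 + H 4"
    unfolding sum_lattice_box_Suc H_def set01234 by simp
  have "supsum3 (F f 0 powr p) (F f 1 powr p) (F f 2 powr p)
      (F g 0 powr p) (F g 1 powr p) (F g 2 powr p) \<le> H 0 + H 1 + H 2 + H 3 + H 4"
    unfolding supsum3_def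
    using FH[of 0 0] FH[of 0 1] FH[of 0 2] FH[of 1 0] FH[of 1 1] FH[of 1 2]
      FH[of 2 0] FH[of 2 1] FH[of 2 2]
    by simp
  moreover have "(F f 0 + F f 1 + F f 2) powr p * (F g 0 + F g 1 + F g 2) powr p
      \<le> supsum3 (F f 0 powr p) (F f 1 powr p) (F f 2 powr p)
          (F g 0 powr p) (F g 1 powr p) (F g 2 powr p)"
    using one_dim[of "F f 0 powr p" "F f 1 powr p" "F f 2 powr p"
        "F g 0 powr p" "F g 1 powr p" "F g 2 powr p"]
    by (simp add: F_pq)
  ultimately show ?case
    unfolding sum_F sum_H by linarith
qed

section \<open>Norms and sup-convolutions as finite sums\<close>

lemma infsum_int_lattice_eq:
  assumes "\<And>x. x \<in> int_lattice d - lattice_box k d \<Longrightarrow> f x = 0"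
  shows "(\<Sum>\<^sub>\<infinity>x\<in>int_lattice d. f x) = (\<Sum>x\<in>lattice_box k d. f x :: real)"
proof -
  have "(\<Sum>\<^sub>\<infinity>x\<in>int_lattice d. f x) = (\<Sum>\<^sub>\<infinity>x\<in>lattice_box k d. f x)"
    using assms by (intro infsum_cong_neutral) (auto simp: lattice_box_def)
  then show ?thesis by (simp add: finite_lattice_box)
qed

lemma int_lattice_diff: "x \<in> int_lattice d \<Longrightarrow> y \<in> int_lattice d \<Longrightarrow> x - y \<in> int_lattice d"
  by (simp add: int_lattice_def)

lemma zero_in_int_lattice: "0 \<in> int_lattice d"
  by (simp add: int_lattice_def)

context
  fixes d :: nat and f g :: "(nat \<Rightarrow> int) \<Rightarrow> real"
  assumes f_nn: "f \<in> int_lattice d \<rightarrow> {0..}" and g_nn: "g \<in> int_lattice d \<rightarrow> {0..}"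
    and f_0: "\<And>x. x \<in> int_lattice d - lattice_box 2 d \<Longrightarrow> f x = 0"
    and g_0: "\<And>x. x \<in> int_lattice d - lattice_box 2 d \<Longrightarrow> g x = 0"
begin

lemma sup_conv_ge:
  assumes "x \<in> int_lattice d"
  shows "f x * g (z - x) \<le> sup_conv d f g z"
  unfolding sup_conv_def
proof (rule cSUP_upper[OF assms])
  \<comment> \<open>Boundedness, without which a real supremum carries no information, holds because
    \<open>f\<close> vanishes off a finite box.\<close>
  have "(\<lambda>x. f x * g (z - x)) ` int_lattice d \<subseteq> insert 0 ((\<lambda>x. f x * g (z - x)) ` lattice_box 2 d)"
    using f_0 by force
  then show "bdd_above ((\<lambda>x. f x * g (z - x)) ` int_lattice d)"
    by (rule bdd_above_mono[rotated]) (simp add: finite_lattice_box)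
qed

lemma sup_conv_nonneg:
  assumes "z \<in> int_lattice d"
  shows "sup_conv d f g z \<ge> 0"
  using sup_conv_ge[OF zero_in_int_lattice, of z] f_nn g_nn zero_in_int_lattice assms
  by (smt (verit) PiE atLeast_iff diff_zero mult_nonneg_nonneg)

lemma sup_conv_eq_0:
  assumes "z \<in> int_lattice d - lattice_box 4 d"
  shows "sup_conv d f g z = 0"
proof -
  have "f x * g (z - x) = 0" if "x \<in> int_lattice d" for x
  proof (rule ccontr)
    assume "f x * g (z - x) \<noteq> 0"
    then have "x \<in> lattice_box 2 d" "z - x \<in> lattice_box 2 d"
      using f_0[of x] g_0[of "z - x"] that assms int_lattice_diff by auto
    from lattice_box_add[OF this] assms show False by simp
  qed
  then have "(\<lambda>x. f x * g (z - x)) ` int_lattice d = {0}"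
    using zero_in_int_lattice by force
  then show ?thesis
    unfolding sup_conv_def by simp
qed

lemma lnorm_sup_conv: "lnorm d 1 (sup_conv d f g) = (\<Sum>z\<in>lattice_box 4 d. sup_conv d f g z)"
proof -
  have "(\<Sum>\<^sub>\<infinity>z\<in>int_lattice d. \<bar>sup_conv d f g z\<bar> powr 1) = (\<Sum>z\<in>lattice_box 4 d. \<bar>sup_conv d f g z\<bar> powr 1)"
    by (rule infsum_int_lattice_eq) (simp add: sup_conv_eq_0)
  also have "\<dots> = (\<Sum>z\<in>lattice_box 4 d. sup_conv d f g z)"
    using sup_conv_nonneg by (intro sum.cong) (auto simp: lattice_box_def)
  finally show ?thesis
    using sum_nonneg[of "lattice_box 4 d" "sup_conv d f g"] sup_conv_nonneg
    by (auto simp: lnorm_def lattice_box_def)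
qed

end

lemma lnorm_eq_sum_lattice_box:
  assumes "\<And>x. x \<in> int_lattice d \<Longrightarrow> f x \<ge> 0" "\<And>x. x \<in> int_lattice d - lattice_box 2 d \<Longrightarrow> f x = 0"
  shows "lnorm d r f = (\<Sum>x\<in>lattice_box 2 d. f x powr r) powr (1 / r)"
proof -
  have "(\<Sum>\<^sub>\<infinity>x\<in>int_lattice d. \<bar>f x\<bar> powr r) = (\<Sum>x\<in>lattice_box 2 d. \<bar>f x\<bar> powr r)"
    by (rule infsum_int_lattice_eq) (simp add: assms(2))
  also have "\<dots> = (\<Sum>x\<in>lattice_box 2 d. f x powr r)"
    using assms(1) by (intro sum.cong) (auto simp: lattice_box_def)
  finally show ?thesis by (simp add: lnorm_def)
qed

lemma card_lattice_box_1: "card (lattice_box k 1) = nat (k + 1)"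
  using bij_betw_same_card[OF bij_betw_lattice_box_Suc[of 0 k]] by (simp add: lattice_box_0 card_cartesian_product)

section \<open>The geometric case\<close>

definition qexp :: real where "qexp = 2 * ln 3 / ln 5"
definition pexp :: real where "pexp = ln 5 / (2 * ln 3)"

lemma pexp_qexp: "pexp * qexp = 1"
  by (simp add: pexp_def qexp_def)

text \<open>This is \<open>5 ^ 15 <= 3 ^ 22\<close>. The cubic at the end of
  \<open>concave_on_geom_num\<close> needs such precision: it is negative at
  \<open>4 / 3\<close>.\<close>

lemma qexp_lower: "15 / 11 \<le> qexp"
proof -
  have "15 * ln 5 = ln ((5::real) ^ 15)" by (subst ln_realpow) auto
  also have "\<dots> \<le> ln (3 ^ 22)" by (subst ln_le_cancel_iff) auto
  also have "\<dots> = 22 * ln (3::real)" by (subst ln_realpow) auto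
  finally show ?thesis by (simp add: qexp_def field_simps)
qed

lemma qexp_upper: "qexp \<le> 7 / 5"
proof -
  have "10 * ln 3 = ln ((3::real) ^ 10)" by (subst ln_realpow) auto
  also have "\<dots> \<le> ln (5 ^ 7)" by (subst ln_le_cancel_iff) auto
  also have "\<dots> = 7 * ln (5::real)" by (subst ln_realpow) auto
  finally show ?thesis by (simp add: qexp_def field_simps)
qed

text \<open>The equality case of constant functions on three points, which fixes the
  exponent.\<close>

lemma three_powr_pexp: "3 powr (2 * pexp) = 5"
  by (simp add: powr_def pexp_def)

lemma pexp_eq: "pexp = 1 / qexp"
  using pexp_qexp qexp_lower by (simp add: field_simps)

section \<open>Convexity of sinh and concavity of the derivative's numerator\<close>

lemma convex_on_sinh: "convex_on {0..} (sinh :: real \<Rightarrow> real)"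
  by (rule f''_ge0_imp_convex[where f' = cosh and f'' = sinh])
     (auto intro!: derivative_eq_intros)

lemma sinh_convex_comb:
  fixes x y t :: real
  assumes "0 \<le> x" "0 \<le> y" "0 \<le> t" "t \<le> 1"
  shows "sinh ((1 - t) * x + t * y) \<le> (1 - t) * sinh x + t * sinh y"
  using convex_onD[OF convex_on_sinh, of t x y] assms by simp

lemma sinh_mult_le:
  fixes a b s :: real
  assumes "0 \<le> a" "a \<le> b" "0 < b" "0 \<le> s"
  shows "sinh (a * s) \<le> a / b * sinh (b * s)"
  using sinh_convex_comb[of 0 "b * s" "a / b"] assms by simp

text \<open>
  Up to a positive factor, the derivative of
  \<open>ln (1 + 2 cosh s + 2 cosh (2 s)) - 2 p ln (1 + 2 cosh (q s))\<close>.
\<close>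

definition geom_num :: "real \<Rightarrow> real" where
  "geom_num s = sinh s + 2 * sinh (2 * s) - 2 * sinh (qexp * s) - sinh ((1 + qexp) * s)
     - 3 * sinh ((qexp - 1) * s) + 4 * sinh ((2 - qexp) * s)"

text \<open>The addition theorems turn the products in the numerator of the derivative into a sum of
  single sinh terms, whose second derivative is easy to estimate.\<close>

lemma geom_num_eq:
  "2 * geom_num s = (2 * sinh s + 4 * sinh (2 * s)) * (1 + 2 * cosh (qexp * s))
     - 4 * sinh (qexp * s) * (1 + 2 * cosh s + 2 * cosh (2 * s))"
proof -
  have "(1 + qexp) * s = s + qexp * s" "(qexp - 1) * s = qexp * s - s"
    "(2 - qexp) * s = 2 * s - qexp * s"
    by (simp_all add: algebra_simps)
  then show ?thesis
    by (simp only: geom_num_def sinh_add sinh_diff) (simp add: algebra_simps)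
qed

text \<open>Convexity of sinh bounds the second derivative by a combination of \<open>A\<close> and
  \<open>B\<close>, then by a multiple of \<open>B\<close> alone; the sign of that multiple is that
  of a cubic in \<open>qexp\<close>.\<close>

lemma concave_on_geom_num: "concave_on {0..} geom_num"
proof (rule f''_le0_imp_concave)
  let ?q = qexp
  let ?d1 = "\<lambda>s. cosh s + 4 * cosh (2 * s) - 2 * ?q * cosh (?q * s) - (1 + ?q) * cosh ((1 + ?q) * s)
     - 3 * (?q - 1) * cosh ((?q - 1) * s) + 4 * (2 - ?q) * cosh ((2 - ?q) * s)"
  let ?d2 = "\<lambda>s. sinh s + 8 * sinh (2 * s) - 2 * ?q\<^sup>2 * sinh (?q * s)
     - (1 + ?q)\<^sup>2 * sinh ((1 + ?q) * s)
     - 3 * (?q - 1)\<^sup>2 * sinh ((?q - 1) * s) + 4 * (2 - ?q)\<^sup>2 * sinh ((2 - ?q) * s)"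
  show "(geom_num has_real_derivative ?d1 s) (at s)" for s
    unfolding geom_num_def by (auto intro!: derivative_eq_intros simp: algebra_simps)
  show "(?d1 has_real_derivative ?d2 s) (at s)" for s
    by (auto intro!: derivative_eq_intros simp: power2_eq_square algebra_simps)
  show "?d2 s \<le> 0" if "s \<in> {0..}" for s
  proof -
    have s: "s \<ge> 0" using that by simp
    have q: "15 / 11 \<le> ?q" "?q \<le> 7 / 5" by (rule qexp_lower qexp_upper)+
    define A B where "A = sinh (?q * s)" and "B = sinh ((1 + ?q) * s)"
    have AB: "A \<ge> 0" "B \<ge> 0" using s q by (auto simp: A_def B_def)
    have 1: "sinh s \<le> 1 / ?q * A"
      using sinh_mult_le[of 1 ?q s] s q by (simp add: A_def)
    \<comment> \<open>Here \<open>2 = (qexp - 1) * qexp + (2 - qexp) * (1 + qexp)\<close> is a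
      convex combination.\<close>
    have 2: "sinh (2 * s) \<le> (?q - 1) * A + (2 - ?q) * B"
      using sinh_convex_comb[of "?q * s" "(1 + ?q) * s" "2 - ?q"] s q
      by (simp add: A_def B_def algebra_simps)
    have 3: "sinh ((2 - ?q) * s) \<le> (2 - ?q) / ?q * A"
      using sinh_mult_le[of "2 - ?q" ?q s] s q by (simp add: A_def)
    have 4: "A \<le> ?q / (1 + ?q) * B"
      using sinh_mult_le[of ?q "1 + ?q" s] s q by (simp add: A_def B_def)
    have 5: "sinh ((?q - 1) * s) \<ge> 0" using s q by simp
    define C where "C = 1 / ?q + 8 * (?q - 1) - 2 * ?q\<^sup>2 + 4 * (2 - ?q)\<^sup>2 * ((2 - ?q) / ?q)"
    have Cq: "C * ?q = 33 - 56 * ?q + 32 * ?q ^ 2 - 6 * ?q ^ 3"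
      using q by (simp add: C_def field_simps power2_eq_square power3_eq_cube)
    have "?d2 s \<le> 1 / ?q * A + 8 * ((?q - 1) * A + (2 - ?q) * B) - 2 * ?q\<^sup>2 * A
      - (1 + ?q)\<^sup>2 * B - 0 + 4 * (2 - ?q)\<^sup>2 * ((2 - ?q) / ?q * A)"
      unfolding A_def[symmetric] B_def[symmetric]
      by (intro add_mono diff_mono mult_left_mono 1 2 3 order.refl) (use 5 in auto)
    also have "\<dots> = C * A + (8 * (2 - ?q) - (1 + ?q)\<^sup>2) * B"
      by (simp add: C_def algebra_simps)
    also have "C * A \<le> C * (?q / (1 + ?q) * B)"
    proof (rule mult_left_mono[OF 4])
      have "33 - 56 * ?q + 32 * ?q ^ 2 - 6 * ?q ^ 3 \<ge> 0"
      proof -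
        \<comment> \<open>The linear factor is the tangent of the square at \<open>7 / 5\<close>,
          and \<open>118 / 5\<close> is \<open>32 - 6 * (7 / 5)\<close>.\<close>
        have "33 - 56 * ?q + (14 / 5 * ?q - 49 / 25) * (118 / 5) \<ge> 0" using q by (simp add: field_simps)
        also have "(14 / 5 * ?q - 49 / 25) * (118 / 5) \<le> ?q\<^sup>2 * (32 - 6 * ?q)"
        proof (rule mult_mono)
          show "14 / 5 * ?q - 49 / 25 \<le> ?q\<^sup>2"
            using zero_le_power2[of "?q - 7 / 5"] by (simp add: power2_eq_square algebra_simps)
        qed (use q in auto)
        finally show ?thesis
          by (simp add: power2_eq_square power3_eq_cube algebra_simps)
      qed
      then have "C * ?q \<ge> 0" unfolding Cq .
      then show "C \<ge> 0" using q by (simp add: zero_le_mult_iff)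
    qed
    also have "C * (?q / (1 + ?q) * B) + (8 * (2 - ?q) - (1 + ?q)\<^sup>2) * B
      = (C * ?q + (8 * (2 - ?q) - (1 + ?q)\<^sup>2) * (1 + ?q)) / (1 + ?q) * B"
      using q by (simp add: field_simps)
    also have "\<dots> = - (7 * ?q ^ 3 - 21 * ?q ^ 2 + 51 * ?q - 48) / (1 + ?q) * B"
      unfolding Cq by (simp add: algebra_simps power2_eq_square power3_eq_cube)
    also have "\<dots> \<le> 0"
    proof -
      have "7 * ?q ^ 3 - 21 * ?q ^ 2 + 51 * ?q - 48 \<ge> 0"
      proof -
        \<comment> \<open>In powers of \<open>qexp - 1\<close> the cubic is visibly increasing, so
          its positive value at \<open>15 / 11\<close> bounds it below.\<close>
        have "(4 / 11) ^ 3 \<le> (?q - 1) ^ 3" using q by (intro power_mono) auto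
        moreover have "7 * ?q ^ 3 - 21 * ?q ^ 2 + 51 * ?q - 48 = 7 * (?q - 1) ^ 3 + 30 * (?q - 1) - 11"
          by (simp add: power2_eq_square power3_eq_cube algebra_simps)
        ultimately show ?thesis using q by (simp add: power3_eq_cube)
      qed
      then show ?thesis using q AB by (intro mult_nonpos_nonneg divide_nonpos_pos) auto
    qed
    finally show ?thesis by simp
  qed
qed simp

text \<open>The logarithm \<open>F\<close> of the quotient vanishes at 0 and at infinity. A negative
  value would force a negative derivative before a positive one, which a concave numerator vanishing
  at 0 excludes.\<close>

lemma geom_cosh_ineq:
  fixes s :: real
  assumes "s \<ge> 0"
  shows "(1 + 2 * cosh (qexp * s)) powr (2 * pexp) \<le> 1 + 2 * cosh s + 2 * cosh (2 * s)"
proof -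
  let ?A = "\<lambda>s::real. 1 + 2 * cosh s + 2 * cosh (2 * s)"
  let ?B = "\<lambda>s. 1 + 2 * cosh (qexp * s)"
  define F where "F s = ln (?A s) - 2 * pexp * ln (?B s)" for s
  have pos: "?A s > 0" "?B s > 0" for s
    using cosh_real_pos[of s] cosh_real_pos[of "2 * s"] cosh_real_pos[of "qexp * s"]
    by linarith+
  have DF: "(F has_real_derivative 2 * geom_num s / (?A s * ?B s)) (at s)" for s
  proof -
    have "(F has_real_derivative (2 * sinh s + 4 * sinh (2 * s)) / ?A s
        - 2 * pexp * ((2 * qexp * sinh (qexp * s)) / ?B s)) (at s)"
      unfolding F_def using pos[of s] by (auto intro!: derivative_eq_intros simp: mult_ac)
    also have "2 * pexp * ((2 * qexp * sinh (qexp * s)) / ?B s)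
        = (pexp * qexp) * (4 * sinh (qexp * s)) / ?B s"
      by simp
    also have "\<dots> = 4 * sinh (qexp * s) / ?B s"
      unfolding pexp_qexp by simp
    also have "(2 * sinh s + 4 * sinh (2 * s)) / ?A s - 4 * sinh (qexp * s) / ?B s
        = 2 * geom_num s / (?A s * ?B s)"
      unfolding geom_num_eq using pos[of s] by (subst diff_frac_eq) auto
    finally show ?thesis .
  qed
  have F0: "F 0 = 0"
    using three_powr_pexp by (simp add: F_def flip: ln_powr)
  have lim: "(F \<longlongrightarrow> 0) at_top"
  proof -
    \<comment> \<open>Factoring out the dominant exponentials isolates linear terms, which cancel in
      \<open>F\<close> because \<open>pexp * qexp = 1\<close>.\<close>
    have A_eq: "ln (?A s) = 2 * s + ln (1 + exp (-s) + exp (-s)^2 + exp (-s)^3 + exp (-s)^4)" for s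
    proof -
      have "?A s = exp (2 * s) * (1 + exp (-s) + exp (-s)^2 + exp (-s)^3 + exp (-s)^4)"
        by (simp add: cosh_field_def add_divide_distrib algebra_simps flip: exp_add exp_of_nat_mult)
      moreover have "1 + exp (-s) + exp (-s)^2 + exp (-s)^3 + exp (-s)^4 > 0"
        by (intro add_pos_pos) auto
      ultimately show ?thesis by (simp add: ln_mult)
    qed
    have B_eq: "ln (?B s) = qexp * s + ln (1 + exp (-(qexp * s)) + exp (-(qexp * s))^2)" for s
    proof -
      have "?B s = exp (qexp * s) * (1 + exp (-(qexp * s)) + exp (-(qexp * s))^2)"
        by (simp add: cosh_field_def add_divide_distrib algebra_simps flip: exp_add exp_of_nat_mult)
      moreover have "1 + exp (-(qexp * s)) + exp (-(qexp * s))^2 > 0"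
        by (intro add_pos_pos) auto
      ultimately show ?thesis by (simp add: ln_mult)
    qed
    have F_eq: "F s = ln (1 + exp (-s) + exp (-s)^2 + exp (-s)^3 + exp (-s)^4)
        - 2 * pexp * ln (1 + exp (-(qexp * s)) + exp (-(qexp * s))^2)" for s
    proof -
      have "2 * pexp * (qexp * s) = 2 * s"
        using pexp_qexp by (simp add: mult.assoc[symmetric])
      then show ?thesis
        unfolding F_def A_eq B_eq by (simp add: right_diff_distrib distrib_left)
    qed
    have 1: "((\<lambda>s::real. exp (-s)) \<longlongrightarrow> 0) at_top"
      by (intro filterlim_compose[OF exp_at_bot] filterlim_uminus_at_bot_at_top)
    have 2: "((\<lambda>s. exp (-(qexp * s))) \<longlongrightarrow> 0) at_top"
      using qexp_lower
      by (intro filterlim_compose[OF 1] filterlim_tendsto_pos_mult_at_top[OF tendsto_const])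
         (auto intro: filterlim_ident)
    have "(F \<longlongrightarrow> ln (1 + 0 + 0^2 + 0^3 + 0^4) - 2 * pexp * ln (1 + 0 + 0^2)) at_top"
      unfolding F_eq by (intro tendsto_intros 1 2) auto
    then show ?thesis by simp
  qed
  have "F s \<ge> 0"
  proof (rule ccontr)
    assume "\<not> F s \<ge> 0"
    then have neg: "F s < 0" by simp
    then have "s > 0" using F0 assms by (cases "s = 0") auto
    obtain s1 where s1: "s1 > s" "F s1 > F s"
    proof -
      have "eventually (\<lambda>x. F x > F s) at_top"
        by (rule order_tendstoD(1)[OF lim neg])
      then have "eventually (\<lambda>x. F x > F s \<and> x > s) at_top"
        using eventually_gt_at_top[of s] by eventually_elim auto
      then show thesis using that eventually_happens'[OF trivial_limit_at_top_linorder] by blast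
    qed
    obtain x where x: "0 < x" "x < s" "F s - F 0 = (s - 0) * (2 * geom_num x / (?A x * ?B x))"
      using MVT2[of 0 s F "\<lambda>x. 2 * geom_num x / (?A x * ?B x)"] DF \<open>s > 0\<close> by blast
    obtain y where y: "s < y" "y < s1" "F s1 - F s = (s1 - s) * (2 * geom_num y / (?A y * ?B y))"
      using MVT2[of s s1 F "\<lambda>x. 2 * geom_num x / (?A x * ?B x)"] DF s1 by blast
    have gx: "geom_num x < 0"
    proof (rule ccontr)
      assume "\<not> geom_num x < 0"
      then have "2 * geom_num x / (?A x * ?B x) \<ge> 0" using pos[of x] by simp
      then show False using x neg F0 \<open>s > 0\<close> by (smt (verit) mult_nonneg_nonneg)
    qed
    have gy: "geom_num y > 0"
    proof (rule ccontr)
      assume "\<not> geom_num y > 0"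
      then have "2 * geom_num y / (?A y * ?B y) \<le> 0" using pos[of y]
        by (intro divide_nonpos_pos mult_pos_pos) auto
      then show False using y s1 by (smt (verit) mult_nonneg_nonpos)
    qed
    have "(1 - x / y) * geom_num 0 + x / y * geom_num y \<le> geom_num ((1 - x / y) * 0 + x / y * y)"
      using concave_onD[OF concave_on_geom_num, of "x / y" 0 y] x y by simp
    moreover have "geom_num 0 = 0" by (simp add: geom_num_def)
    moreover have "x / y * geom_num y > 0" using gy x y by (intro mult_pos_pos divide_pos_pos) auto
    ultimately show False using gx x y by simp
  qed
  then have "ln (?B s powr (2 * pexp)) \<le> ln (?A s)"
    using pos[of s] by (simp add: F_def ln_powr)
  then show ?thesis using pos[of s] by (subst (asm) ln_le_cancel_iff) auto
qed

section \<open>The one-dimensional inequality\<close>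

text \<open>The derivative can change sign only from plus to minus, so the minimum sits at an end
  point. This replaces concavity in a transformed variable.\<close>

lemma nonneg_of_deriv_sign_change:
  fixes f r w :: "real \<Rightarrow> real"
  assumes ends: "f a \<ge> 0" "f b \<ge> 0" and x: "a \<le> x" "x \<le> b"
    and cont: "continuous_on {a..b} f"
    and deriv: "\<And>x. a < x \<Longrightarrow> x < b \<Longrightarrow> (f has_real_derivative w x * r x) (at x)"
    and w: "\<And>x. a < x \<Longrightarrow> x < b \<Longrightarrow> w x > 0"
    and r: "\<And>x y. a < x \<Longrightarrow> x \<le> y \<Longrightarrow> y < b \<Longrightarrow> r y \<le> r x"
  shows "f x \<ge> 0"
proof (rule ccontr)
  assume "\<not> f x \<ge> 0"
  then have neg: "f x < 0" by simp
  with ends x have ax: "a < x" and xb: "x < b"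
    by (auto simp: order.order_iff_strict)
  have diff: "f differentiable (at y)" if "a < y" "y < b" for y
    using deriv[OF that] by (auto simp: real_differentiable_def)
  obtain l y where y: "a < y" "y < x" "(f has_real_derivative l) (at y)" "f x - f a = (x - a) * l"
    using MVT[OF ax continuous_on_subset[OF cont]] diff xb by auto
  obtain m z where z: "x < z" "z < b" "(f has_real_derivative m) (at z)" "f b - f x = (b - x) * m"
    using MVT[OF xb continuous_on_subset[OF cont]] diff ax by auto
  have "l = w y * r y" "m = w z * r z"
    using DERIV_unique[OF y(3) deriv] DERIV_unique[OF z(3) deriv] y z ax xb by auto
  moreover have "(x - a) * l < 0" "(b - x) * m > 0"
    using y z neg ends by auto
  ultimately have "r y < 0" "r z > 0"
    using ax xb w[of y] w[of z] y z by (auto simp: mult_less_0_iff zero_less_mult_iff)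
  moreover have "r z \<le> r y" using r[of y z] y z by simp
  ultimately show False by simp
qed

text \<open>Both sides equal 1 at \<open>x = 0\<close>, and \<open>end1\<close> is the case
  \<open>x = 1\<close>. In the variable \<open>x powr qexp\<close> the left side is affine and the
  right side concave.\<close>

lemma quadratic_powr_ge:
  fixes m n k x :: real
  assumes m: "m > 0" and n: "0 \<le> n" "n \<le> m\<^sup>2" and x: "0 \<le> x" "x \<le> 1"
    and end1: "1 + k \<le> (1 + m + n) powr (qexp / 2)"
  shows "1 + k * x powr qexp \<le> (1 + m * x + n * x\<^sup>2) powr (qexp / 2)"
proof -
  define u where "u x = 1 + m * x + n * x\<^sup>2" for x
  define \<rho> where "\<rho> x = (qexp / 2 - 1) * ln (u x) + ln (m + 2 * n * x) + (1 - qexp) * ln x" for x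
  have q: "4 / 3 \<le> qexp" "qexp < 2" using qexp_lower qexp_upper by auto
  have u_pos: "u x > 0" and v_pos: "m + 2 * n * x > 0" if "x \<ge> 0" for x
    using that m n by (auto simp: u_def intro!: add_pos_nonneg)
  \<comment> \<open>\<open>exp (\<rho> x) / 2\<close> is the derivative of \<open>u\<^sup>q\<^sup>/\<^sup>2\<close> with respect to \<open>x\<^sup>q\<close>; it decreases,
    i.e. \<open>u\<^sup>q\<^sup>/\<^sup>2\<close> is a concave function of \<open>x\<^sup>q\<close>.\<close>
  have "(u x powr (qexp / 2) - 1 - k * x powr qexp) \<ge> 0"
  proof (rule nonneg_of_deriv_sign_change
      [where f = "\<lambda>x. u x powr (qexp / 2) - 1 - k * x powr qexp" and a = 0 and b = 1 and x = x
        and w = "\<lambda>x. qexp * x powr (qexp - 1)" and r = "\<lambda>x. exp (\<rho> x) / 2 - k"])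
    show "continuous_on {0..1} (\<lambda>x. u x powr (qexp / 2) - 1 - k * x powr qexp)"
    proof (intro continuous_on_diff continuous_on_mult continuous_on_const)
      have "continuous_on {0..1} u" unfolding u_def by (intro continuous_intros)
      then show "continuous_on {0..1} (\<lambda>x. u x powr (qexp / 2))"
        using u_pos by (intro continuous_on_powr continuous_on_const) force+
      show "continuous_on {0..1} (\<lambda>x::real. x powr qexp)"
        using q by (intro continuous_on_powr' continuous_on_id continuous_on_const) auto
    qed
    fix x :: real assume "0 < x"
    then have u: "u x > 0" and v: "m + 2 * n * x > 0" using u_pos v_pos by auto
    have "exp (\<rho> x) = u x powr (qexp / 2 - 1) * (m + 2 * n * x) * x powr (1 - qexp)"
      using u v \<open>0 < x\<close> by (simp add: \<rho>_def exp_add powr_def)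
    then have "x powr (qexp - 1) * exp (\<rho> x)
        = u x powr (qexp / 2 - 1) * (m + 2 * n * x) * (x powr (1 - qexp) * x powr (qexp - 1))"
      by simp
    also have "x powr (1 - qexp) * x powr (qexp - 1) = 1"
      using \<open>0 < x\<close> by (simp flip: powr_add)
    finally have *: "x powr (qexp - 1) * exp (\<rho> x) = u x powr (qexp / 2 - 1) * (m + 2 * n * x)"
      by simp
    have "((\<lambda>x. u x powr (qexp / 2) - 1 - k * x powr qexp) has_real_derivative
        (qexp / 2) * (u x powr (qexp / 2 - 1) * (m + 2 * n * x)) - k * (qexp * x powr (qexp - 1))) (at x)"
      using u \<open>0 < x\<close> unfolding u_def by (auto intro!: derivative_eq_intros)
    then show "((\<lambda>x. u x powr (qexp / 2) - 1 - k * x powr qexp) has_real_derivative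
        qexp * x powr (qexp - 1) * (exp (\<rho> x) / 2 - k)) (at x)"
      unfolding *[symmetric] by (simp add: algebra_simps)
    show "qexp * x powr (qexp - 1) > 0" using \<open>0 < x\<close> q by simp
    fix y assume "x \<le> y"
    have "\<rho> y \<le> \<rho> x"
    proof (rule DERIV_nonpos_imp_nonincreasing[OF \<open>x \<le> y\<close>])
      fix t assume "x \<le> t" "t \<le> y"
      then have t: "t > 0" using \<open>0 < x\<close> by simp
      have u: "u t > 0" and v: "m + 2 * n * t > 0" using u_pos v_pos t by auto
      let ?v = "m + 2 * n * t"
      have "(\<rho> has_real_derivative (qexp / 2 - 1) * (?v / u t) + 2 * n / ?v + (1 - qexp) / t) (at t)"
        unfolding \<rho>_def[abs_def] using u v t
        by (auto intro!: derivative_eq_intros simp: u_def)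
      moreover have "(qexp / 2 - 1) * (?v / u t) + 2 * n / ?v + (1 - qexp) / t \<le> 0"
      proof -
        \<comment> \<open>The derivative of the logarithm decreases in the exponent, since
          \<open>?v * t <= 2 * u t\<close>, so exponent \<open>4 / 3\<close> is the worst case;
          clearing denominators there leaves this inequality.\<close>
        have "n * (4 * t - m * t\<^sup>2) \<le> m + 2 * m\<^sup>2 * t"
        proof (cases "4 * t - m * t\<^sup>2 \<ge> 0")
          case True
          then have "n * (4 * t - m * t\<^sup>2) \<le> m\<^sup>2 * (4 * t - m * t\<^sup>2)"
            using n by (intro mult_right_mono)
          moreover have "m * (1 - m * t)\<^sup>2 \<ge> 0" using m by simp
          ultimately show ?thesis by (simp add: power2_eq_square algebra_simps)
        next
          case False
          then have "n * (4 * t - m * t\<^sup>2) \<le> 0" using n by (intro mult_nonneg_nonpos) auto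
          also have "0 \<le> m + 2 * m\<^sup>2 * t" using m t by simp
          finally show ?thesis .
        qed
        then have "6 * n * t * u t \<le> ?v * (?v * t + u t)"
          by (simp add: u_def power2_eq_square algebra_simps)
        then have 1: "2 * n / ?v \<le> (1 / 3) * (?v / u t) + (1 / 3) / t"
          using u v t by (simp add: field_simps)
        have "?v * t \<le> 2 * u t" using m n t by (simp add: u_def power2_eq_square algebra_simps)
        then have "?v / u t \<le> 2 / t" using u t by (simp add: field_simps)
        then have "(qexp - 4 / 3) * (?v / u t) \<le> (qexp - 4 / 3) * (2 / t)"
          using q by (intro mult_left_mono) auto
        with 1 show ?thesis by (simp add: algebra_simps add_divide_distrib diff_divide_distrib)
      qed
      ultimately show "\<exists>y. (\<rho> has_real_derivative y) (at t) \<and> y \<le> 0" by blast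
    qed
    then show "exp (\<rho> y) / 2 - k \<le> exp (\<rho> x) / 2 - k" by simp
  qed (use x end1 in \<open>auto simp: u_def\<close>)
  then show ?thesis by (simp add: u_def)
qed

lemma powr_qexp_pexp: "x \<ge> 0 \<Longrightarrow> (x powr (qexp / 2)) powr (2 * pexp) = x"
  using pexp_qexp by (simp add: powr_powr mult.commute)

lemma powr_pexp_qexp: "x \<ge> 0 \<Longrightarrow> (x powr (2 * pexp)) powr (qexp / 2) = x"
  using pexp_qexp by (simp add: powr_powr)

lemma pexp_pos: "pexp > 0"
  by (simp add: pexp_def)

lemma qexp_pos: "qexp > 0"
  by (simp add: qexp_def)

lemma powr_pexp_homogeneous:
  assumes "b > 0" "T \<ge> 0"
  shows "(b powr qexp * T) powr (2 * pexp) = b\<^sup>2 * T powr (2 * pexp)"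
proof -
  have "(b powr qexp) powr (2 * pexp) = b powr 2"
  proof -
    have "qexp * (2 * pexp) = 2" using pexp_qexp by algebra
    then show ?thesis by (simp only: powr_powr)
  qed
  then show ?thesis using assms by (simp add: powr_mult)
qed

text \<open>The case of a vanishing entry: scale the larger number to 1 and use
  \<open>quadratic_powr_ge\<close> with \<open>m = n = k = 1\<close>.\<close>

lemma powr_sum2_le:
  assumes "a \<ge> 0" "b \<ge> 0"
  shows "(a powr qexp + b powr qexp) powr (2 * pexp) \<le> a\<^sup>2 + a * b + b\<^sup>2"
proof -
  have *: "(a powr qexp + b powr qexp) powr (2 * pexp) \<le> a\<^sup>2 + a * b + b\<^sup>2"
    if "0 \<le> a" "a \<le> b" for a b :: real
  proof (cases "b = 0")
    case False
    then have b: "b > 0" using that by simp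
    define x where "x = a / b"
    have x: "0 \<le> x" "x \<le> 1" and a: "a = b * x" using that b by (auto simp: x_def)
    \<comment> \<open>The end point condition \<open>2 <= 3 powr (qexp / 2)\<close> follows from
      \<open>8 <= 9\<close> and \<open>qexp / 2 >= 2 / 3\<close>.\<close>
    have "2 = (8::real) powr (1 / 3)"
      using powr_powr[of 2 3 "1/3"] by simp
    also have "\<dots> \<le> 9 powr (1 / 3)" by (intro powr_mono2) auto
    also have "\<dots> = 3 powr (2 / 3)"
      using powr_powr[of 3 2 "1/3"] by simp
    also have "\<dots> \<le> 3 powr (qexp / 2)" using qexp_lower by (intro powr_mono) auto
    finally have "1 + x powr qexp \<le> (1 + x + x\<^sup>2) powr (qexp / 2)"
      using quadratic_powr_ge[of 1 1 x 1] x by simp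
    then have "(1 + x powr qexp) powr (2 * pexp) \<le> ((1 + x + x\<^sup>2) powr (qexp / 2)) powr (2 * pexp)"
      using pexp_pos by (intro powr_mono2) auto
    also have "\<dots> = 1 + x + x\<^sup>2" using x by (intro powr_qexp_pexp) auto
    finally have "b\<^sup>2 * (1 + x powr qexp) powr (2 * pexp) \<le> b\<^sup>2 * (1 + x + x\<^sup>2)"
      by (intro mult_left_mono) auto
    moreover have "a powr qexp + b powr qexp = b powr qexp * (1 + x powr qexp)"
      using b x by (simp add: a powr_mult algebra_simps)
    ultimately show ?thesis using powr_pexp_homogeneous[OF b, of "1 + x powr qexp"]
      by (simp add: a power2_eq_square algebra_simps)
  qed (use that in auto)
  show ?thesis
    using *[of a b] *[of b a] assms by (cases "a \<le> b") (auto simp: algebra_simps)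
qed

text \<open>This is \<open>geom_cosh_ineq\<close> at \<open>s = ln t\<close>; the symmetry between
  \<open>t\<close> and \<open>1 / t\<close> allows \<open>t >= 1\<close>.\<close>

lemma geometric_powr_le:
  fixes t :: real
  assumes "t > 0"
  shows "(1 + (t powr qexp + (1 / t) powr qexp)) powr (2 * pexp) \<le> 1 + (t + 1 / t) + (t\<^sup>2 + (1 / t)\<^sup>2)"
proof -
  have *: "(1 + (t powr qexp + (1 / t) powr qexp)) powr (2 * pexp) \<le> 1 + (t + 1 / t) + (t\<^sup>2 + (1 / t)\<^sup>2)"
    if "t \<ge> 1" for t :: real
  proof -
    have t: "t > 0" "t = exp (ln t)" using that by auto
    have "2 * cosh (ln t) = t + 1 / t"
      using t by (simp add: cosh_ln_real field_simps)
    moreover have "2 * cosh (2 * ln t) = t\<^sup>2 + (1 / t)\<^sup>2"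
      using t cosh_ln_real[of "t\<^sup>2"] by (simp add: ln_realpow field_simps)
    moreover have "2 * cosh (qexp * ln t) = t powr qexp + (1 / t) powr qexp"
      using t cosh_ln_real[of "t powr qexp"] by (simp add: ln_powr powr_divide field_simps)
    ultimately show ?thesis
      using geom_cosh_ineq[of "ln t"] that by (simp add: add.assoc)
  qed
  show ?thesis
    using *[of t] *[of "1 / t"] assms by (cases "t \<ge> 1") (auto simp: add_ac)
qed

lemma supsum3_diag_ge:
  assumes "a \<ge> 0" "b \<ge> 0" "c \<ge> 0"
  shows "(a powr qexp + b powr qexp + c powr qexp) powr (2 * pexp) \<le> supsum3 a b c a b c"
proof -
  consider "b = 0 \<or> a = 0 \<or> c = 0" | "b > 0" "a > 0" "c > 0" "a * c \<le> b\<^sup>2"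
    | "b > 0" "a > 0" "c > 0" "b\<^sup>2 < a * c"
    using assms by fastforce
  then show ?thesis
  proof cases
    case 1
    then show ?thesis
      using assms powr_sum2_le[of a c] powr_sum2_le[of b c] powr_sum2_le[of a b]
      unfolding supsum3_diag by (auto simp: max_absorb1 max_absorb2)
  next
    case 2
    \<comment> \<open>The triple is \<open>b\<close> times \<open>(r * t, 1, r / t)\<close> with
      \<open>r\<close> the first quantity defined here: it is geometric for \<open>r = 1\<close> and
      has only its middle entry for \<open>r = 0\<close>.\<close>
    define \<rho> t where "\<rho> = sqrt (a * c) / b" and "t = sqrt (a / c)"
    have t: "t > 0" using 2 by (simp add: t_def)
    have \<rho>: "0 \<le> \<rho>" "\<rho> \<le> 1"
      using 2 real_le_lsqrt[of b "a * c"] by (auto simp: \<rho>_def intro: real_le_lsqrt)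
    have a: "a = b * (\<rho> * t)" and c: "c = b * (\<rho> * (1 / t))"
      using 2 by (auto simp: \<rho>_def t_def real_sqrt_mult real_sqrt_divide)
    define m n k where "m = t + 1 / t" and "n = t\<^sup>2 + (1 / t)\<^sup>2"
      and "k = t powr qexp + (1 / t) powr qexp"
    have mn: "m > 0" "n \<ge> 0" "n \<le> m\<^sup>2"
      using t by (auto simp: m_def n_def power2_sum intro: add_pos_pos)
    have k: "k \<ge> 0" by (simp add: k_def)
    have "1 + k \<le> (1 + m + n) powr (qexp / 2)"
    proof -
      have "((1 + k) powr (2 * pexp)) powr (qexp / 2) \<le> (1 + m + n) powr (qexp / 2)"
        using geometric_powr_le[OF t] qexp_pos unfolding m_def n_def k_def
        by (intro powr_mono2) auto
      then show ?thesis using k by (simp add: powr_pexp_qexp)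
    qed
    then have "1 + k * \<rho> powr qexp \<le> (1 + m * \<rho> + n * \<rho>\<^sup>2) powr (qexp / 2)"
      using quadratic_powr_ge mn \<rho> by blast
    then have "(1 + k * \<rho> powr qexp) powr (2 * pexp)
        \<le> ((1 + m * \<rho> + n * \<rho>\<^sup>2) powr (qexp / 2)) powr (2 * pexp)"
      using pexp_pos k by (intro powr_mono2) auto
    also have "\<dots> = 1 + m * \<rho> + n * \<rho>\<^sup>2"
      using mn \<rho> by (intro powr_qexp_pexp) auto
    finally have "b\<^sup>2 * (1 + k * \<rho> powr qexp) powr (2 * pexp) \<le> b\<^sup>2 * (1 + m * \<rho> + n * \<rho>\<^sup>2)"
      by (intro mult_left_mono) auto
    moreover have "a powr qexp + b powr qexp + c powr qexp = b powr qexp * (1 + k * \<rho> powr qexp)"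
      using 2 \<rho> t by (simp add: a c k_def powr_mult powr_divide algebra_simps)
    moreover have "supsum3 a b c a b c = b\<^sup>2 * (1 + m * \<rho> + n * \<rho>\<^sup>2)"
    proof -
      have "supsum3 a b c a b c = a\<^sup>2 + a * b + b\<^sup>2 + b * c + c\<^sup>2"
        using 2 by (simp add: supsum3_diag)
      also have "\<dots> = b\<^sup>2 * (1 + m * \<rho> + n * \<rho>\<^sup>2)"
        unfolding a c m_def n_def by (simp add: power2_eq_square algebra_simps)
      finally show ?thesis .
    qed
    ultimately show ?thesis
      using powr_pexp_homogeneous[of b "1 + k * \<rho> powr qexp"] 2 k by simp
  next
    case 3
    \<comment> \<open>\<open>B\<close> is the middle entry that makes \<open>(a, B, c)\<close>
      geometric.\<close>
    define B R where "B = sqrt (a * c)" and "R = a powr qexp + c powr qexp"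
    define s where "s = b / B"
    have B: "B > 0" "B\<^sup>2 = a * c" using 3 by (auto simp: B_def)
    have s: "0 < s" "s \<le> 1" "b = s * B"
      using 3 B real_le_rsqrt[of b "a * c"] by (auto simp: s_def B_def)
    have q: "qexp \<ge> 1" using qexp_lower by simp
    have p: "2 * pexp \<ge> 1" using qexp_upper qexp_pos by (simp add: pexp_eq field_simps)
    \<comment> \<open>\<open>l\<close> is the position of \<open>b powr qexp\<close> between 0 and
      \<open>B powr qexp\<close>; \<open>l <= s\<close> expresses the concavity of \<open>b\<close>
      in \<open>b powr qexp\<close>.\<close>
    define l where "l = s powr qexp"
    have l: "0 \<le> l" "l \<le> s" "l \<le> 1"
      using s q powr_mono'[of 1 qexp s] by (auto simp: l_def)
    \<comment> \<open>As a function of \<open>b\<^sup>q\<close>, \<open>supsum3 a b c a b c\<close> is concave and the left-hand side is convex,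
      so it suffices to look at the end points \<open>b = 0\<close> and \<open>b = B\<close>.\<close>
    have geo: "(R + B powr qexp) powr (2 * pexp) \<le> a\<^sup>2 + a * B + a * c + B * c + c\<^sup>2"
    proof -
      define t where "t = sqrt (a / c)"
      have t: "t > 0" using 3 by (simp add: t_def)
      have ac: "a = B * t" "c = B * (1 / t)"
        using 3 by (auto simp: B_def t_def real_sqrt_mult real_sqrt_divide)
      have "R + B powr qexp = B powr qexp * (1 + (t powr qexp + (1 / t) powr qexp))"
        unfolding R_def ac using t B by (simp add: powr_mult powr_divide algebra_simps)
      then have "(R + B powr qexp) powr (2 * pexp)
          = B\<^sup>2 * (1 + (t powr qexp + (1 / t) powr qexp)) powr (2 * pexp)"
        using powr_pexp_homogeneous[OF B(1), of "1 + (t powr qexp + (1 / t) powr qexp)"] by simp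
      also have "\<dots> \<le> B\<^sup>2 * (1 + (t + 1 / t) + (t\<^sup>2 + (1 / t)\<^sup>2))"
        by (intro mult_left_mono geometric_powr_le t) auto
      also have "\<dots> = a\<^sup>2 + a * B + a * c + B * c + c\<^sup>2"
        unfolding ac using t by (simp add: power2_eq_square algebra_simps)
      finally show ?thesis .
    qed
    have "a powr qexp + b powr qexp + c powr qexp = (1 - l) *\<^sub>R R + l *\<^sub>R (R + B powr qexp)"
      using s B by (simp add: R_def l_def powr_mult algebra_simps)
    also have "\<dots> powr (2 * pexp) \<le> (1 - l) * R powr (2 * pexp) + l * (R + B powr qexp) powr (2 * pexp)"
      using 3 B l by (intro convex_onD[OF powr_convex[OF p]]) (auto simp: R_def intro!: add_pos_pos)
    also have "\<dots> \<le> (1 - l) * (a\<^sup>2 + a * c + c\<^sup>2) + l * (a\<^sup>2 + a * B + a * c + B * c + c\<^sup>2)"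
      using geo powr_sum2_le[of a c] 3 l unfolding R_def
      by (intro add_mono mult_left_mono) auto
    also have "\<dots> = a\<^sup>2 + a * c + c\<^sup>2 + l * ((a + c) * B)"
      by (simp add: algebra_simps)
    also have "\<dots> \<le> a\<^sup>2 + a * c + c\<^sup>2 + s * ((a + c) * B)"
      using l B 3 by (intro add_left_mono mult_right_mono) auto
    also have "\<dots> = supsum3 a b c a b c"
      using 3 by (simp add: supsum3_diag s(3)[symmetric] max_absorb2)(simp add: s(3) algebra_simps)
    finally show ?thesis .
  qed
qed

text \<open>After squaring, the two diagonal inequalities multiply and
  \<open>supsum3_square_ge\<close> bounds the product.\<close>

lemma supsum3_ge:
  assumes "a \<ge> 0" "b \<ge> 0" "c \<ge> 0" "x \<ge> 0" "y \<ge> 0" "z \<ge> 0"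
  shows "(a powr qexp + b powr qexp + c powr qexp) powr pexp
    * (x powr qexp + y powr qexp + z powr qexp) powr pexp \<le> supsum3 a b c x y z"
proof (rule power2_le_imp_le)
  have sq: "(T powr pexp)\<^sup>2 = T powr (2 * pexp)" for T :: real
    by (simp add: power2_eq_square flip: powr_add)
  have "((a powr qexp + b powr qexp + c powr qexp) powr pexp
      * (x powr qexp + y powr qexp + z powr qexp) powr pexp)\<^sup>2
    \<le> supsum3 a b c a b c * supsum3 x y z x y z"
    unfolding power_mult_distrib sq
    using assms supsum3_diag_ge[of x y z] supsum3_diag_ge[of a b c]
    by (intro mult_mono) (auto intro: order.trans[OF powr_ge_zero])
  also have "\<dots> \<le> (supsum3 a b c x y z)\<^sup>2"
    using assms by (rule supsum3_square_ge)
  finally show "((a powr qexp + b powr qexp + c powr qexp) powr pexp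
      * (x powr qexp + y powr qexp + z powr qexp) powr pexp)\<^sup>2 \<le> (supsum3 a b c x y z)\<^sup>2" .
  show "supsum3 a b c x y z \<ge> 0"
    using assms unfolding supsum3_def by (intro add_nonneg_nonneg) (auto simp: le_max_iff_disj)
qed

section \<open>Norm inequality, sumset bound and sharpness\<close>

theorem theorem1p1:
  fixes p q :: real
  defines "q \<equiv> 2 * ln 3 / ln 5"
    and "p \<equiv> ln 5 / (2 * ln 3)"
  shows
    "(\<forall>d\<ge>1. \<forall>f g.
        f \<in> int_lattice d \<rightarrow> {0..} \<longrightarrow> g \<in> int_lattice d \<rightarrow> {0..} \<longrightarrow>
        (\<forall>x\<in>int_lattice d - cube012 d. f x = 0) \<longrightarrow>
        (\<forall>x\<in>int_lattice d - cube012 d. g x = 0) \<longrightarrow>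
        lnorm d 1 (sup_conv d f g) \<ge> lnorm d q f * lnorm d q g)
   \<and> (\<forall>d\<ge>1. \<forall>A B. A \<subseteq> cube012 d \<longrightarrow> B \<subseteq> cube012 d \<longrightarrow>
        real (card (A + B)) \<ge> real (card A) powr p * real (card B) powr p)
   \<and> (\<forall>p'>p. \<not> (\<forall>d\<ge>1. \<forall>A B. A \<subseteq> cube012 d \<longrightarrow> B \<subseteq> cube012 d \<longrightarrow>
        real (card (A + B)) \<ge> real (card A) powr p' * real (card B) powr p'))"
proof (intro conjI allI impI)
  have q: "q = qexp" and p: "p = pexp"
    by (simp_all add: p_def q_def pexp_def qexp_def)
  note sum_ge = sum_lattice_box_ge_prod[OF supsum3_ge pexp_qexp]
  show "lnorm d q f * lnorm d q g \<le> lnorm d 1 (sup_conv d f g)"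
    if nn: "f \<in> int_lattice d \<rightarrow> {0..}" "g \<in> int_lattice d \<rightarrow> {0..}"
      and supp: "\<forall>x\<in>int_lattice d - cube012 d. f x = 0" "\<forall>x\<in>int_lattice d - cube012 d. g x = 0"
    for d and f g :: "(nat \<Rightarrow> int) \<Rightarrow> real"
  proof -
    have f0: "\<And>x. x \<in> int_lattice d - lattice_box 2 d \<Longrightarrow> f x = 0"
      and g0: "\<And>x. x \<in> int_lattice d - lattice_box 2 d \<Longrightarrow> g x = 0"
      using supp by (auto simp: cube012_eq_lattice_box)
    have fg: "\<And>x. x \<in> int_lattice d \<Longrightarrow> f x \<ge> 0" "\<And>x. x \<in> int_lattice d \<Longrightarrow> g x \<ge> 0"
      using nn by auto
    have "(\<Sum>x\<in>lattice_box 2 d. f x powr qexp) powr pexp * (\<Sum>x\<in>lattice_box 2 d. g x powr qexp) powr pexp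
      \<le> (\<Sum>z\<in>lattice_box 4 d. sup_conv d f g z)"
    proof (rule sum_ge)
      fix x y assume "x \<in> lattice_box 2 d" "y \<in> lattice_box 2 d"
      then show "f x * g y \<le> sup_conv d f g (x + y)"
        using sup_conv_ge[OF nn f0 g0, of x "x + y"] by (simp add: lattice_box_def)
    qed (auto simp: fg lattice_box_def)
    then show ?thesis
      using lnorm_sup_conv[OF nn f0 g0] lnorm_eq_sum_lattice_box[OF fg(1) f0]
        lnorm_eq_sum_lattice_box[OF fg(2) g0]
      by (simp add: q pexp_eq)
  qed
  show "real (card A) powr p * real (card B) powr p \<le> real (card (A + B))"
    if "A \<subseteq> cube012 d" "B \<subseteq> cube012 d" for d and A B :: "(nat \<Rightarrow> int) set"
  proof -
    have sub: "A \<subseteq> lattice_box 2 d" "B \<subseteq> lattice_box 2 d"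
      using that by (simp_all add: cube012_eq_lattice_box)
    have "x + y \<in> lattice_box 4 d" if "x \<in> A" "y \<in> B" for x y
      using lattice_box_add[of x 2 d y 2] that sub by auto
    then have sub4: "A + B \<subseteq> lattice_box 4 d"
      by (auto simp: set_plus_def)
    have sum_ind: "(\<Sum>x\<in>lattice_box k d. indicator C x) = real (card C)"
      if "C \<subseteq> lattice_box k d" for C k
      using that by (simp add: indicator_def sum.If_cases finite_lattice_box Int_absorb1)
    have powr_ind: "indicator C x powr qexp = (indicator C x :: real)" for C and x :: "nat \<Rightarrow> int"
      by (simp add: indicator_def)
    \<comment> \<open>The majorant is the indicator of \<open>A + B\<close> itself, so the sum on
      the right counts the sumset directly.\<close>
    have "(\<Sum>x\<in>lattice_box 2 d. indicator A x powr qexp) powr pexp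
        * (\<Sum>x\<in>lattice_box 2 d. indicator B x powr qexp) powr pexp
      \<le> (\<Sum>z\<in>lattice_box 4 d. indicator (A + B) z)"
      by (rule sum_ge) (auto simp: indicator_def set_plus_intro)
    then show ?thesis
      by (simp add: p powr_ind sum_ind sub sub4)
  qed
  show "\<not> (\<forall>d\<ge>1. \<forall>A B. A \<subseteq> cube012 d \<longrightarrow> B \<subseteq> cube012 d \<longrightarrow>
      real (card A) powr p' * real (card B) powr p' \<le> real (card (A + B)))" if "p' > p" for p'
  proof
    \<comment> \<open>Dimension 1 suffices: the full cube has 3 points and its sumset at most 5,
      while \<open>3 powr (2 * pexp) = 5\<close>.\<close>
    let ?C = "cube012 1"
    assume "\<forall>d\<ge>1. \<forall>A B. A \<subseteq> cube012 d \<longrightarrow> B \<subseteq> cube012 d \<longrightarrow>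
      real (card A) powr p' * real (card B) powr p' \<le> real (card (A + B))"
    then have "real (card ?C) powr p' * real (card ?C) powr p' \<le> real (card (?C + ?C))"
      by blast
    moreover have "card (?C + ?C) \<le> 5"
    proof -
      have "?C + ?C \<subseteq> lattice_box 4 1"
        using lattice_box_add[of _ 2 1 _ 2] by (auto simp: set_plus_def cube012_eq_lattice_box)
      then have "card (?C + ?C) \<le> card (lattice_box 4 1)"
        by (intro card_mono finite_lattice_box)
      then show ?thesis by (simp add: card_lattice_box_1 del: One_nat_def)
    qed
    moreover have "card ?C = 3"
      by (simp add: card_lattice_box_1 cube012_eq_lattice_box del: One_nat_def)
    ultimately have "3 powr (2 * p') \<le> 5"
      by (simp flip: powr_add)
    moreover have "(3::real) powr (2 * pexp) < 3 powr (2 * p')"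
      using that by (intro powr_less_mono) (auto simp: p)
    ultimately show False by (simp add: three_powr_pexp)
  qed
qed

end
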